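(* Let $n\ge 2$ and $m\ge 1$ be integers, let $B\subset\mathbb{Z}^n$ be an $n$-box, and let $f:\partial B\to\mathbb{Z}^{n-1}$ be $(c_n,c_1^m)$-continuous. Then there is some point $x\in\partial B$ such that $f(x)$ and $f(-x)$ are equal or $c_1^{2m}$-adjacent.
   Context: For integers $1\le k\le N$, two distinct points of $\mathbb{Z}^N$ are $c_k$-adjacent if their coordinates differ by at most 1 in at most $k$ positions and are equal in all other positions. Subsets of $\mathbb{Z}^N$ carry the restricted relation. A function $f$ from a set with adjacency $\kappa$ to a set with adjacency $\lambda$ is $(\kappa,\lambda)$-continuous if whenever $a,b$ are $\kappa$-adjacent, $f(a)$ and $f(b)$ are $\lambda$-adjacent or equal. For an adjacency $\lambda$ on $Y$, a $\lambda$-path of length $k$ from $a$ to $b$ is a function $p:\{0,\dots,k\}\to Y$ with $p(0)=a$, $p(k)=b$ such that $p(i)$ and $p(i+1)$ are $\lambda$-adjacent or equal for each $i$; $a$ is $\lambda^k$-adjacent to $b$ iff there is a $\lambda$-path of length $k$ from $a$ to $b$ in $Y$. (Here $c_1^m$ and $c_1^{2m}$ are formed in $\mathbb{Z}^{n-1}$.) An $n$-box is a set $B=\prod_{i=1}^n\{a_i,a_i+1,\dots,b_i\}\subset\mathbb{Z}^n$ with $a_i,b_i\in\mathbb{Z}$ and $a_i<b_i$ for each $i$. Its boundary is $\partial B=\bigcup_{i=1}^n(\{x\in B:x_i=a_i\}\cup\{x\in B:x_i=b_i\})$. For $x\in B$, $-x$ denotes the antipodal point $(a_1+b_1-x_1,\dots,a_n+b_n-x_n)$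 (not the additive inverse); this map preserves $\partial B$. *)

theory Defs
  imports Main "HOL-Library.FuncSet"
begin

text \<open>Points of \<open>\<int>\<^sup>N\<close> are the functions on the index set \<open>{..<N}\<close> (indices start at 0), made
  extensional so that equality of functions is equality of points.\<close>

definition lattice_points :: "nat \<Rightarrow> (nat \<Rightarrow> int) set" where
  "lattice_points N = (\<Pi>\<^sub>E i\<in>{..<N}. UNIV)"

definition c_adj :: "nat \<Rightarrow> nat \<Rightarrow> (nat \<Rightarrow> int) \<Rightarrow> (nat \<Rightarrow> int) \<Rightarrow> bool" where
  "c_adj N k x y \<longleftrightarrow>
     x \<in> lattice_points N \<and> y \<in> lattice_points N \<and> x \<noteq> y \<and>
     (\<exists>S \<subseteq> {..<N}. card S \<le> k \<and> (\<forall>i\<in>S. \<bar>x i - y i\<bar> \<le> 1) \<and> (\<forall>i\<in>{..<N} - S. x i = y i))"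

text \<open>In the next two definitions an adjacency on a set is a relation on the ambient type, of
  which only the restriction to that set matters.\<close>

definition digitally_continuous ::
  "'a set \<Rightarrow> ('a \<Rightarrow> 'a \<Rightarrow> bool) \<Rightarrow> 'b set \<Rightarrow> ('b \<Rightarrow> 'b \<Rightarrow> bool) \<Rightarrow> ('a \<Rightarrow> 'b) \<Rightarrow> bool" where
  "digitally_continuous X \<kappa> Y \<mu> f \<longleftrightarrow>
     f \<in> X \<rightarrow> Y \<and> (\<forall>a\<in>X. \<forall>b\<in>X. \<kappa> a b \<longrightarrow> \<mu> (f a) (f b) \<or> f a = f b)"

definition digital_path ::
  "'a set \<Rightarrow> ('a \<Rightarrow> 'a \<Rightarrow> bool) \<Rightarrow> nat \<Rightarrow> 'a \<Rightarrow> 'a \<Rightarrow> (nat \<Rightarrow> 'a) \<Rightarrow> bool" where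
  "digital_path Y \<mu> k a b p \<longleftrightarrow>
     p \<in> {0..k} \<rightarrow> Y \<and> p 0 = a \<and> p k = b \<and>
     (\<forall>i<k. \<mu> (p i) (p (Suc i)) \<or> p i = p (Suc i))"

text \<open>The power \<open>\<mu>\<^sup>k\<close> of an adjacency. It is reflexive on \<open>Y\<close>, since paths may pause.\<close>

definition adj_power ::
  "'a set \<Rightarrow> ('a \<Rightarrow> 'a \<Rightarrow> bool) \<Rightarrow> nat \<Rightarrow> 'a \<Rightarrow> 'a \<Rightarrow> bool" where
  "adj_power Y \<mu> k a b \<longleftrightarrow> (\<exists>p. digital_path Y \<mu> k a b p)"

definition n_box :: "nat \<Rightarrow> (nat \<Rightarrow> int) \<Rightarrow> (nat \<Rightarrow> int) \<Rightarrow> (nat \<Rightarrow> int) set" where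
  "n_box n a b = (\<Pi>\<^sub>E i\<in>{..<n}. {a i..b i})"

definition box_boundary :: "nat \<Rightarrow> (nat \<Rightarrow> int) \<Rightarrow> (nat \<Rightarrow> int) \<Rightarrow> (nat \<Rightarrow> int) set" where
  "box_boundary n a b =
     (\<Union>i<n. {x \<in> n_box n a b. x i = a i} \<union> {x \<in> n_box n a b. x i = b i})"

definition box_antipode ::
  "nat \<Rightarrow> (nat \<Rightarrow> int) \<Rightarrow> (nat \<Rightarrow> int) \<Rightarrow> (nat \<Rightarrow> int) \<Rightarrow> nat \<Rightarrow> int" where
  "box_antipode n a b x = (\<lambda>i\<in>{..<n}. a i + b i - x i)"

end

theory Submission
  imports Defs "HOL-Library.Z2" Complex_Main
begin

text \<open>A point is \<open>c\<^sub>1\<^sup>k\<close>-adjacent to another iff their \<open>\<ell>\<^sub>1\<close> distance is at most \<open>k\<close>. So let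
  \<open>g x = f x - f (-x)\<close>, an odd function on the lattice points of \<open>\<partial>B\<close> whose values at
  \<open>c\<^sub>n\<close>-adjacent points have \<open>\<ell>\<^sub>1\<close> distance at most \<open>2 m\<close>; a point with \<open>\<ell>\<^sub>1\<close> norm of \<open>g\<close> at most \<open>2 m\<close> is
  wanted. Multilinear interpolation extends \<open>g\<close> to an odd continuous map \<open>G\<close> from the boundary of the
  real box to real \<open>(n - 1)\<close>-space, and by the theorem of Borsuk and Ulam \<open>G\<close> has a zero. There, a weighted
  average of values of \<open>g\<close> at the corners of one unit cell vanishes. These corners are
  pairwise adjacent, so each of the values is within \<open>2 m\<close> of the others and hence of their
  average, the origin (\<open>l1_norm_le_if_average_small\<close>).

  A point where \<open>G\<close> is almost zero suffices, because norms of \<open>g\<close> are integers. This makes the proof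
  finite: the approximate form of the theorem of Borsuk and Ulam (\<open>approximate_borsuk_ulam\<close>) is a parity
  statement about subdivisions of the octahedral sphere. For odd functions \<open>s\<^sub>1, \<dots>, s\<^sub>d\<close> with values in two
  signs, consider the cup product modulo two of the cochains that mark the edges on which \<open>s\<^sub>i\<close>
  changes. Its value on a subdivided \<open>d\<close>-dimensional hemisphere is \<open>1\<close> (\<open>hemisphere_sign_changes\<close>).
  The reason is that the product is the coboundary of \<open>s\<^sub>1\<close> times the remaining factors, while the boundary of a
  hemisphere is a smaller hemisphere together with its antipode; oddness of \<open>s\<^sub>1\<close> reduces the claim to
  one dimension less. With the signs of the coordinates of \<open>G\<close>, this yields arbitrarily small simplices
  on which all coordinates change sign.

  Only the values of cochains on chains occur, so a chain is represented by the linear functional that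
  evaluates cochains on it, and subdivision by its transpose.\<close>

section \<open>Cochains modulo two\<close>

text \<open>Bit operations would replace sums and products by conjunctions and symmetric differences, which
  hide the field laws that the computations below rely on.\<close>

declare add_bit_eq_xor [simp del] mult_bit_eq_and [simp del]

lemma bit_add_self: "x + x = (0::bit)"
  by (cases x) simp_all

text \<open>The simplicial coboundary of the augmented complex, in which the empty list is the simplex of
  dimension \<open>-1\<close>. Splitting off the face opposite to the first vertex turns the usual relations
  between iterated faces into inductions on lists.\<close>

fun coboundary :: "('a list \<Rightarrow> bit) \<Rightarrow> 'a list \<Rightarrow> bit" where
  "coboundary \<phi> [] = 0"
| "coboundary \<phi> (x # xs) = \<phi> xs + coboundary (\<lambda>\<tau>. \<phi> (x # \<tau>)) xs"

lemma coboundary_add: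
  "coboundary (\<lambda>\<tau>. \<phi> \<tau> + \<psi> \<tau>) \<sigma> = coboundary \<phi> \<sigma> + coboundary \<psi> \<sigma>"
  by (induction \<sigma> arbitrary: \<phi> \<psi>) (simp_all add: ac_simps)

lemma coboundary_zero: "coboundary (\<lambda>\<tau>. 0) \<sigma> = 0"
  by (induction \<sigma>) simp_all

lemma coboundary_scale: "coboundary (\<lambda>\<tau>. c * \<phi> \<tau>) \<sigma> = c * coboundary \<phi> \<sigma>"
  by (induction \<sigma> arbitrary: \<phi>) (simp_all add: distrib_left)

lemma coboundary_coboundary: "coboundary (coboundary \<phi>) \<sigma> = 0"
proof (induction \<sigma> arbitrary: \<phi>)
  case (Cons x xs)
  have "coboundary (coboundary \<phi>) (x # xs)
      = coboundary \<phi> xs + coboundary (\<lambda>\<tau>. \<phi> \<tau> + coboundary (\<lambda>\<rho>. \<phi> (x # \<rho>)) \<tau>) xs"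
    by simp
  also have "\<dots> = coboundary \<phi> xs
                  + (coboundary \<phi> xs + coboundary (coboundary (\<lambda>\<rho>. \<phi> (x # \<rho>))) xs)"
    by (simp only: coboundary_add)
  also have "\<dots> = 0"
    by (simp only: Cons.IH add_0_right bit_add_self)
  finally show ?case .
qed simp

lemma coboundary_map: "coboundary (\<lambda>\<tau>. \<phi> (map h \<tau>)) \<sigma> = coboundary \<phi> (map h \<sigma>)"
proof (induction \<sigma> arbitrary: \<phi>)
  case (Cons x xs)
  show ?case
    using Cons.IH[of "\<lambda>\<tau>. \<phi> (h x # \<tau>)"] by simp
qed simp

text \<open>Every argument about where a cochain is nonzero uses this form: a nonzero value of a derived
  cochain is traced back to a nonzero value of the original one on some simplex that is part of
  the given one.\<close>

lemma coboundary_support: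
  assumes "coboundary \<phi> \<sigma> = 1"
  shows "\<exists>\<tau>. \<phi> \<tau> = 1 \<and> Suc (length \<tau>) = length \<sigma> \<and> set \<tau> \<subseteq> set \<sigma>"
  using assms
proof (induction \<sigma> arbitrary: \<phi>)
  case (Cons x xs)
  then consider "\<phi> xs = 1" | "coboundary (\<lambda>\<tau>. \<phi> (x # \<tau>)) xs = 1"
    by (cases "\<phi> xs") auto
  then show ?case
  proof cases
    case 2
    then obtain \<tau> where "\<phi> (x # \<tau>) = 1" "Suc (length \<tau>) = length xs" "set \<tau> \<subseteq> set xs"
      using Cons.IH by blast
    then show ?thesis by (intro exI[of _ "x # \<tau>"]) auto
  qed auto
qed simp

lemma coboundary_cong:
  assumes "\<And>\<tau>. Suc (length \<tau>) = length \<sigma> \<Longrightarrow> \<phi> \<tau> = \<psi> \<tau>"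
  shows "coboundary \<phi> \<sigma> = coboundary \<psi> \<sigma>"
  using assms
proof (induction \<sigma> arbitrary: \<phi> \<psi>)
  case (Cons x xs)
  have "coboundary (\<lambda>\<tau>. \<phi> (x # \<tau>)) xs = coboundary (\<lambda>\<tau>. \<psi> (x # \<tau>)) xs"
    using Cons.prems by (intro Cons.IH) simp
  then show ?case
    using Cons.prems[of xs] by simp
qed simp

section \<open>Barycentric subdivision\<close>

type_synonym point = "nat \<Rightarrow> real"

definition neg :: "point \<Rightarrow> point" where
  "neg v = (\<lambda>i. - v i)"

definition barycenter :: "point list \<Rightarrow> point" where
  "barycenter \<sigma> = (\<lambda>i. (\<Sum>v\<leftarrow>\<sigma>. v i) / length \<sigma>)"

lemma barycenter_map_neg: "barycenter (map neg \<sigma>) = neg (barycenter \<sigma>)"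
  by (simp add: barycenter_def neg_def o_def fun_eq_iff uminus_sum_list_map minus_divide_left)

text \<open>Barycentric subdivision acts on chains by \<open>sd \<sigma> = b * sd (\<partial>\<sigma>)\<close>: the boundary is subdivided and
  coned off from the barycenter. This is the transpose of that operator, which evaluates a
  cochain on the subdivided simplex; the counter is the number of vertices, as the recursion
  descends through the faces.\<close>

fun subdivide_steps :: "nat \<Rightarrow> (point list \<Rightarrow> bit) \<Rightarrow> point list \<Rightarrow> bit" where
  "subdivide_steps 0 \<phi> \<sigma> = \<phi> \<sigma>"
| "subdivide_steps (Suc n) \<phi> \<sigma> =
     coboundary (subdivide_steps n (\<lambda>\<tau>. \<phi> (barycenter \<sigma> # \<tau>))) \<sigma>"

definition subdivide :: "(point list \<Rightarrow> bit) \<Rightarrow> point list \<Rightarrow> bit" where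
  "subdivide \<phi> \<sigma> = subdivide_steps (length \<sigma>) \<phi> \<sigma>"

lemma subdivide_steps_add:
  "subdivide_steps n (\<lambda>\<tau>. \<phi> \<tau> + \<psi> \<tau>) \<sigma> = subdivide_steps n \<phi> \<sigma> + subdivide_steps n \<psi> \<sigma>"
proof (induction n arbitrary: \<phi> \<psi> \<sigma>)
  case (Suc n)
  have "subdivide_steps n (\<lambda>\<tau>. \<phi> (barycenter \<sigma> # \<tau>) + \<psi> (barycenter \<sigma> # \<tau>))
      = (\<lambda>\<rho>. subdivide_steps n (\<lambda>\<tau>. \<phi> (barycenter \<sigma> # \<tau>)) \<rho>
           + subdivide_steps n (\<lambda>\<tau>. \<psi> (barycenter \<sigma> # \<tau>)) \<rho>)"
    by (intro ext Suc.IH)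
  then show ?case
    by (simp add: coboundary_add)
qed simp

lemma subdivide_steps_neg:
  "subdivide_steps n (\<lambda>\<tau>. \<phi> (map neg \<tau>)) \<sigma> = subdivide_steps n \<phi> (map neg \<sigma>)"
proof (induction n arbitrary: \<phi> \<sigma>)
  case (Suc n)
  have "subdivide_steps n (\<lambda>\<tau>. \<phi> (neg (barycenter \<sigma>) # map neg \<tau>))
      = (\<lambda>\<rho>. subdivide_steps n (\<lambda>\<tau>. \<phi> (barycenter (map neg \<sigma>) # \<tau>)) (map neg \<rho>))"
    using Suc.IH[of "\<lambda>\<tau>. \<phi> (neg (barycenter \<sigma>) # \<tau>)"] by (intro ext) (simp add: barycenter_map_neg)
  then show ?case
    using coboundary_map[of "subdivide_steps n (\<lambda>\<tau>. \<phi> (barycenter (map neg \<sigma>) # \<tau>))" neg \<sigma>]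
    by (simp add: barycenter_map_neg)
qed simp

text \<open>Evaluating \<open>coboundary \<phi>\<close> on a cone with apex \<open>b\<close> gives \<open>\<phi>\<close> on the base plus the coboundary of
  \<open>\<phi> (b # _)\<close> on the base. On the subdivided boundary of \<open>\<sigma>\<close>, the second part is by induction a double
  coboundary and vanishes.\<close>

lemma subdivide_steps_coboundary:
  "length \<sigma> = n \<Longrightarrow>
     subdivide_steps n (coboundary \<phi>) \<sigma> = coboundary (subdivide_steps (n - 1) \<phi>) \<sigma>"
proof (induction n arbitrary: \<phi> \<sigma>)
  case (Suc n)
  let ?\<phi> = "\<lambda>\<tau>. \<phi> (barycenter \<sigma> # \<tau>)"
  have "subdivide_steps (Suc n) (coboundary \<phi>) \<sigma>
      = coboundary (\<lambda>\<tau>. subdivide_steps n \<phi> \<tau> + subdivide_steps n (coboundary ?\<phi>) \<tau>) \<sigma>"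
    by (simp flip: subdivide_steps_add)
  also have "\<dots> = coboundary (subdivide_steps n \<phi>) \<sigma>
                  + coboundary (subdivide_steps n (coboundary ?\<phi>)) \<sigma>"
    by (simp add: coboundary_add)
  also have "coboundary (subdivide_steps n (coboundary ?\<phi>)) \<sigma>
           = coboundary (coboundary (subdivide_steps (n - 1) ?\<phi>)) \<sigma>"
    using Suc by (intro coboundary_cong) auto
  finally show ?case
    by (simp add: coboundary_coboundary)
qed simp

lemma subdivide_coboundary: "subdivide (coboundary \<phi>) = coboundary (subdivide \<phi>)"
proof
  fix \<sigma>
  have "coboundary (subdivide_steps (length \<sigma> - 1) \<phi>) \<sigma> = coboundary (subdivide \<phi>) \<sigma>"
    by (rule coboundary_cong) (auto simp: subdivide_def dest: sym)
  then show "subdivide (coboundary \<phi>) \<sigma> = coboundary (subdivide \<phi>) \<sigma>"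
    by (simp add: subdivide_def subdivide_steps_coboundary)
qed

text \<open>Subdivision only ever forms barycenters, so closure under them serves as convexity.\<close>

definition mean_closed :: "point set \<Rightarrow> bool" where
  "mean_closed S \<longleftrightarrow> (\<forall>\<sigma>. \<sigma> \<noteq> [] \<and> set \<sigma> \<subseteq> S \<longrightarrow> barycenter \<sigma> \<in> S)"

definition spread :: "real \<Rightarrow> point list \<Rightarrow> bool" where
  "spread r \<sigma> \<longleftrightarrow> (\<forall>u\<in>set \<sigma>. \<forall>v\<in>set \<sigma>. \<forall>i. \<bar>u i - v i\<bar> \<le> r)"

lemma sum_list_diff_const:
  fixes c :: real
  shows "(\<Sum>v\<leftarrow>\<sigma>. h v - c) = (\<Sum>v\<leftarrow>\<sigma>. h v) - length \<sigma> * c"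
  by (induction \<sigma>) (simp_all add: algebra_simps)

lemma sum_list_abs_le:
  fixes r :: real
  assumes "\<And>v. v \<in> set \<sigma> \<Longrightarrow> \<bar>h v\<bar> \<le> r"
  shows "\<bar>\<Sum>v\<leftarrow>\<sigma>. h v\<bar> \<le> length \<sigma> * r"
  using assms
proof (induction \<sigma>)
  case (Cons a \<sigma>)
  have "\<bar>h a\<bar> \<le> r" "\<bar>\<Sum>v\<leftarrow>\<sigma>. h v\<bar> \<le> length \<sigma> * r"
    using Cons by auto
  then show ?case
    using abs_triangle_ineq[of "h a" "\<Sum>v\<leftarrow>\<sigma>. h v"] by (simp add: algebra_simps)
qed simp

lemma barycenter_mem_band:
  assumes "\<sigma> \<noteq> []" "\<And>v. v \<in> set \<sigma> \<Longrightarrow> \<bar>c - v i\<bar> \<le> (r::real)"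
  shows "\<bar>c - barycenter \<sigma> i\<bar> \<le> r"
proof -
  have pos: "real (length \<sigma>) > 0"
    using assms(1) by simp
  have "\<bar>\<Sum>v\<leftarrow>\<sigma>. v i - c\<bar> \<le> length \<sigma> * r"
    using assms(2) by (intro sum_list_abs_le) (simp add: abs_minus_commute)
  moreover have "(\<Sum>v\<leftarrow>\<sigma>. v i - c) = length \<sigma> * (barycenter \<sigma> i - c)"
    using pos by (simp add: sum_list_diff_const barycenter_def field_simps)
  ultimately have "length \<sigma> * \<bar>barycenter \<sigma> i - c\<bar> \<le> length \<sigma> * r"
    by (simp add: abs_mult)
  then show ?thesis
    using pos by (simp add: abs_minus_commute)
qed

lemma mean_closed_band: "mean_closed {w. \<forall>i. \<bar>c i - w i\<bar> \<le> r}"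
  by (auto simp: mean_closed_def intro!: barycenter_mem_band)

text \<open>In the average of the differences \<open>u - v\<close> over the vertices \<open>u\<close>, the term \<open>u = v\<close> is zero, which
  saves one part in \<open>length \<sigma>\<close>.\<close>

lemma barycenter_vertex_distance:
  assumes v: "v \<in> set \<sigma>" and r: "spread r \<sigma>" and D: "length \<sigma> \<le> D"
  shows "\<bar>barycenter \<sigma> i - v i\<bar> \<le> r * (1 - 1 / real D)"
proof -
  have pos: "real (length \<sigma>) > 0" and D': "real D > 0"
    using v D by (auto simp: length_pos_if_in_set)
      (meson le_neq_implies_less length_pos_if_in_set less_le_trans not_gr_zero)
  have r0: "r \<ge> 0"
    using r v unfolding spread_def by fastforce
  obtain xs ys where \<sigma>: "\<sigma> = xs @ v # ys"
    using v by (meson split_list)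
  have "\<bar>\<Sum>u\<leftarrow>xs @ ys. u i - v i\<bar> \<le> length (xs @ ys) * r"
    using r \<sigma> by (intro sum_list_abs_le) (auto simp: spread_def)
  moreover have "(\<Sum>u\<leftarrow>xs @ ys. u i - v i) = length \<sigma> * (barycenter \<sigma> i - v i)"
  proof -
    have "(\<Sum>u\<leftarrow>xs @ ys. u i - v i) = (\<Sum>u\<leftarrow>\<sigma>. u i - v i)"
      by (simp add: \<sigma>)
    also have "\<dots> = (\<Sum>u\<leftarrow>\<sigma>. u i) - length \<sigma> * v i"
      by (rule sum_list_diff_const)
    also have "\<dots> = length \<sigma> * (barycenter \<sigma> i - v i)"
      using pos by (simp add: barycenter_def right_diff_distrib)
    finally show ?thesis .
  qed
  moreover have "real (length (xs @ ys)) = length \<sigma> - 1"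
    by (simp add: \<sigma>)
  ultimately have "length \<sigma> * \<bar>barycenter \<sigma> i - v i\<bar> \<le> (real (length \<sigma>) - 1) * r"
    using pos by (simp add: abs_mult \<sigma>)
  then have "\<bar>barycenter \<sigma> i - v i\<bar> \<le> (real (length \<sigma>) - 1) * r / length \<sigma>"
    using pos by (simp add: field_simps)
  also have "\<dots> = r * (1 - 1 / length \<sigma>)"
    using pos by (simp add: field_simps)
  also have "\<dots> \<le> r * (1 - 1 / real D)"
    using pos D' D r0 by (intro mult_left_mono diff_left_mono) (simp_all add: frac_le)
  finally show ?thesis .
qed

text \<open>The new simplex consists of the barycenter of \<open>\<sigma>\<close> and a simplex of a subdivided face. The distance
  from the barycenter to the vertices of \<open>\<sigma>\<close> bounds its distance to everything in their hull.\<close>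

lemma subdivide_steps_support:
  assumes "subdivide_steps n \<phi> \<sigma> = 1" "length \<sigma> = n" "n \<le> D"
  shows "\<exists>\<tau>. \<phi> \<tau> = 1 \<and> length \<tau> = n \<and>
           (\<forall>S. mean_closed S \<longrightarrow> set \<sigma> \<subseteq> S \<longrightarrow> set \<tau> \<subseteq> S) \<and>
           (\<forall>r. spread r \<sigma> \<longrightarrow> spread (r * (1 - 1 / real D)) \<tau>)"
  using assms
proof (induction n arbitrary: \<phi> \<sigma>)
  case 0
  then show ?case by (intro exI[of _ "[]"]) (auto simp: spread_def)
next
  case (Suc n)
  let ?b = "barycenter \<sigma>"
  obtain \<rho> where \<rho>: "subdivide_steps n (\<lambda>\<tau>. \<phi> (?b # \<tau>)) \<rho> = 1"
      "length \<rho> = n" "set \<rho> \<subseteq> set \<sigma>"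
    using coboundary_support[of _ \<sigma>] Suc.prems by fastforce
  from Suc.IH[OF \<rho>(1,2)] Suc.prems obtain \<tau> where \<tau>: "\<phi> (?b # \<tau>) = 1" "length \<tau> = n"
      "\<And>S. mean_closed S \<Longrightarrow> set \<rho> \<subseteq> S \<Longrightarrow> set \<tau> \<subseteq> S"
      "\<And>r. spread r \<rho> \<Longrightarrow> spread (r * (1 - 1 / real D)) \<tau>"
    by (auto simp: Suc_le_eq)
  have ne: "\<sigma> \<noteq> []"
    using Suc.prems by auto
  have "spread (r * (1 - 1 / real D)) (?b # \<tau>)" if r: "spread r \<sigma>" for r
  proof -
    let ?r = "r * (1 - 1 / real D)"
    have "\<bar>?b i - v i\<bar> \<le> ?r" if "v \<in> set \<sigma>" for v i
      using barycenter_vertex_distance[OF that r] Suc.prems by simp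
    then have "set \<sigma> \<subseteq> {w. \<forall>i. \<bar>?b i - w i\<bar> \<le> ?r}"
      by auto
    \<comment> \<open>a band around the barycenter is convex, so it contains the subdivided face as well\<close>
    then have "set \<tau> \<subseteq> {w. \<forall>i. \<bar>?b i - w i\<bar> \<le> ?r}"
      using \<rho>(3) by (intro \<tau>(3) mean_closed_band) auto
    moreover have "spread ?r \<tau>"
      using r \<rho>(3) by (intro \<tau>(4)) (auto simp: spread_def)
    moreover have "?r \<ge> 0"
    proof -
      obtain v where "v \<in> set \<sigma>"
        using ne by (meson hd_in_set)
      then show ?thesis
        using barycenter_vertex_distance[OF _ r, of v D 0] Suc.prems by (simp add: abs_le_iff)
    qed
    ultimately show ?thesis
      by (auto simp: spread_def abs_minus_commute)
  qed
  moreover have "set (?b # \<tau>) \<subseteq> S" if "mean_closed S" "set \<sigma> \<subseteq> S" for S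
    using that \<rho>(3) \<tau>(3)[of S] ne by (auto simp: mean_closed_def)
  ultimately show ?case
    using \<tau>(1,2) by (intro exI[of _ "?b # \<tau>"]) auto
qed

lemma iterated_subdivide_coboundary:
  "(subdivide ^^ N) (coboundary \<phi>) = coboundary ((subdivide ^^ N) \<phi>)"
  by (induction N) (simp_all add: subdivide_coboundary)

lemma iterated_subdivide_add:
  "(subdivide ^^ N) (\<lambda>\<tau>. \<phi> \<tau> + \<psi> \<tau>) \<sigma> = (subdivide ^^ N) \<phi> \<sigma> + (subdivide ^^ N) \<psi> \<sigma>"
proof (induction N arbitrary: \<phi> \<psi>)
  case (Suc N)
  have "subdivide (\<lambda>\<tau>. \<phi> \<tau> + \<psi> \<tau>) = (\<lambda>\<tau>. subdivide \<phi> \<tau> + subdivide \<psi> \<tau>)"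
    by (simp add: subdivide_def subdivide_steps_add fun_eq_iff)
  then show ?case
    by (simp only: funpow_Suc_right o_apply Suc.IH)
qed simp

lemma iterated_subdivide_neg:
  "(subdivide ^^ N) (\<lambda>\<tau>. \<phi> (map neg \<tau>)) \<sigma> = (subdivide ^^ N) \<phi> (map neg \<sigma>)"
proof (induction N arbitrary: \<phi>)
  case (Suc N)
  have "subdivide (\<lambda>\<tau>. \<phi> (map neg \<tau>)) = (\<lambda>\<tau>. subdivide \<phi> (map neg \<tau>))"
    by (simp add: subdivide_def subdivide_steps_neg fun_eq_iff)
  then show ?case
    by (simp only: funpow_Suc_right o_apply Suc.IH)
qed simp

text \<open>Iteration makes the simplices as small as desired, because the mesh shrinks by a factor that
  depends on the dimension only.\<close>

lemma iterated_subdivide_support: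
  assumes "(subdivide ^^ N) \<phi> \<sigma> = 1" "length \<sigma> \<le> D"
  shows "\<exists>\<tau>. \<phi> \<tau> = 1 \<and> length \<tau> = length \<sigma> \<and>
           (\<forall>S. mean_closed S \<longrightarrow> set \<sigma> \<subseteq> S \<longrightarrow> set \<tau> \<subseteq> S) \<and>
           (\<forall>r. spread r \<sigma> \<longrightarrow> spread (r * (1 - 1 / real D) ^ N) \<tau>)"
  using assms
proof (induction N arbitrary: \<sigma>)
  case 0
  then show ?case by (intro exI[of _ \<sigma>]) auto
next
  case (Suc N)
  then have "subdivide_steps (length \<sigma>) ((subdivide ^^ N) \<phi>) \<sigma> = 1"
    by (simp add: subdivide_def[of "(subdivide ^^ N) \<phi>"])
  from subdivide_steps_support[OF this refl Suc.prems(2)] obtain \<rho> where \<rho>: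
      "(subdivide ^^ N) \<phi> \<rho> = 1" "length \<rho> = length \<sigma>"
      "\<forall>S. mean_closed S \<longrightarrow> set \<sigma> \<subseteq> S \<longrightarrow> set \<rho> \<subseteq> S"
      "\<forall>r. spread r \<sigma> \<longrightarrow> spread (r * (1 - 1 / real D)) \<rho>"
    by blast
  then obtain \<tau> where \<tau>: "\<phi> \<tau> = 1" "length \<tau> = length \<rho>"
      "\<forall>S. mean_closed S \<longrightarrow> set \<rho> \<subseteq> S \<longrightarrow> set \<tau> \<subseteq> S"
      "\<forall>r. spread r \<rho> \<longrightarrow> spread (r * (1 - 1 / real D) ^ N) \<tau>"
    using Suc.IH[of \<rho>] Suc.prems by auto
  have "spread (r * (1 - 1 / real D) ^ Suc N) \<tau>" if "spread r \<sigma>" for r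
    using \<rho>(4) \<tau>(4) that by (metis mult.assoc power_Suc)
  then show ?case
    using \<rho>(2,3) \<tau>(1,2,3) by (intro exI[of _ \<tau>]) auto
qed

section \<open>Hemispheres of the octahedral sphere\<close>

definition axis_point :: "nat \<Rightarrow> real \<Rightarrow> point" where
  "axis_point k t = (\<lambda>i. if i = k then t else 0)"

text \<open>The sum of a cochain over the simplices with vertices \<open>(\<plusminus>e (k - 1), \<dots>, \<plusminus>e 0)\<close>, over all
  choices of signs. These triangulate the unit sphere of the \<open>\<ell>\<^sub>1\<close> norm in real \<open>k\<close>-space. The hemisphere below consists of the
  simplices of the next sphere whose vertex on the last axis is positive.\<close>

primrec octahedral_sphere :: "nat \<Rightarrow> (point list \<Rightarrow> bit) \<Rightarrow> bit" where
  "octahedral_sphere 0 \<phi> = \<phi> []"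
| "octahedral_sphere (Suc k) \<phi> = octahedral_sphere k
     (\<lambda>\<tau>. \<phi> (axis_point k 1 # \<tau>) + \<phi> (axis_point k (-1) # \<tau>))"

definition hemisphere :: "nat \<Rightarrow> (point list \<Rightarrow> bit) \<Rightarrow> bit" where
  "hemisphere k \<phi> = octahedral_sphere k (\<lambda>\<tau>. \<phi> (axis_point k 1 # \<tau>))"

lemma neg_axis_point: "neg (axis_point k t) = axis_point k (- t)"
  by (auto simp: neg_def axis_point_def)

lemma octahedral_sphere_add:
  "octahedral_sphere k (\<lambda>\<tau>. \<phi> \<tau> + \<psi> \<tau>) = octahedral_sphere k \<phi> + octahedral_sphere k \<psi>"
proof (induction k arbitrary: \<phi> \<psi>)
  case (Suc k)
  have "octahedral_sphere (Suc k) (\<lambda>\<tau>. \<phi> \<tau> + \<psi> \<tau>) = octahedral_sphere k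
     (\<lambda>\<tau>. (\<phi> (axis_point k 1 # \<tau>) + \<phi> (axis_point k (-1) # \<tau>))
        + (\<psi> (axis_point k 1 # \<tau>) + \<psi> (axis_point k (-1) # \<tau>)))"
    by (simp add: ac_simps)
  then show ?case
    by (simp only: Suc.IH octahedral_sphere.simps)
qed simp

lemma octahedral_sphere_neg:
  "octahedral_sphere k (\<lambda>\<tau>. \<phi> (map neg \<tau>)) = octahedral_sphere k \<phi>"
proof (induction k arbitrary: \<phi>)
  case (Suc k)
  show ?case
    using Suc.IH[of "\<lambda>\<tau>. \<phi> (axis_point k 1 # \<tau>) + \<phi> (axis_point k (-1) # \<tau>)"]
    by (simp add: neg_axis_point add.commute)
qed simp

text \<open>The octahedral sphere is a cycle: it is the suspension of the previous one, whose simplices are the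
  bases of exactly two cones.\<close>

lemma octahedral_sphere_coboundary: "octahedral_sphere k (coboundary \<phi>) = 0"
proof (induction k arbitrary: \<phi>)
  case (Suc k)
  let ?p = "\<lambda>\<tau>. \<phi> (axis_point k 1 # \<tau>)" and ?m = "\<lambda>\<tau>. \<phi> (axis_point k (-1) # \<tau>)"
  have "octahedral_sphere (Suc k) (coboundary \<phi>)
      = octahedral_sphere k (\<lambda>\<tau>. (\<phi> \<tau> + coboundary ?p \<tau>) + (\<phi> \<tau> + coboundary ?m \<tau>))"
    by simp
  also have "\<dots> = (octahedral_sphere k \<phi> + octahedral_sphere k (coboundary ?p))
                  + (octahedral_sphere k \<phi> + octahedral_sphere k (coboundary ?m))"
    by (simp only: octahedral_sphere_add)
  also have "\<dots> = 0"
    by (simp only: Suc.IH add_0_right bit_add_self)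
  finally show ?case .
qed simp

lemma hemisphere_add: "hemisphere k (\<lambda>\<tau>. \<phi> \<tau> + \<psi> \<tau>) = hemisphere k \<phi> + hemisphere k \<psi>"
  by (simp add: hemisphere_def octahedral_sphere_add)

text \<open>The boundary of a hemisphere is the equatorial sphere, and this is the union of a lower-dimensional
  hemisphere and its antipode.\<close>

lemma hemisphere_coboundary:
  "hemisphere (Suc k) (coboundary \<phi>) = hemisphere k (\<lambda>\<tau>. \<phi> \<tau> + \<phi> (map neg \<tau>))"
proof -
  have "hemisphere (Suc k) (coboundary \<phi>)
      = octahedral_sphere (Suc k)
          (\<lambda>\<tau>. \<phi> \<tau> + coboundary (\<lambda>\<rho>. \<phi> (axis_point (Suc k) 1 # \<rho>)) \<tau>)"
    by (simp add: hemisphere_def)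
  also have "\<dots> = octahedral_sphere (Suc k) \<phi>"
    by (simp only: octahedral_sphere_add octahedral_sphere_coboundary add_0_right)
  also have "\<dots> = hemisphere k \<phi> + octahedral_sphere k (\<lambda>\<tau>. \<phi> (axis_point k (-1) # \<tau>))"
    by (simp add: hemisphere_def octahedral_sphere_add)
  also have "octahedral_sphere k (\<lambda>\<tau>. \<phi> (axis_point k (-1) # \<tau>))
           = hemisphere k (\<lambda>\<tau>. \<phi> (map neg \<tau>))"
    using octahedral_sphere_neg[of k "\<lambda>\<tau>. \<phi> (axis_point k (-1) # \<tau>)"]
    by (simp add: hemisphere_def neg_axis_point)
  finally show ?thesis
    by (simp add: hemisphere_add)
qed

definition l1_sphere :: "nat \<Rightarrow> point set" where
  "l1_sphere n = {v. (\<Sum>i<n. \<bar>v i\<bar>) = 1 \<and> (\<forall>i\<ge>n. v i = 0)}"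

text \<open>The face of the \<open>\<ell>\<^sub>1\<close> sphere with signs \<open>s\<close>. Unlike the sphere it is convex, so subdivision does not
  leave it; in particular no vertex of a subdivision is the origin, where antipodes would
  coincide.\<close>

definition octant_simplex :: "nat \<Rightarrow> (nat \<Rightarrow> real) \<Rightarrow> point set" where
  "octant_simplex n s = {v. (\<Sum>i<n. s i * v i) = 1 \<and> (\<forall>i<n. s i * v i \<ge> 0) \<and> (\<forall>i\<ge>n. v i = 0)}"

lemma sum_list_sum_swap:
  fixes h :: "'a \<Rightarrow> 'b \<Rightarrow> real"
  shows "(\<Sum>i\<in>I. \<Sum>v\<leftarrow>\<sigma>. h i v) = (\<Sum>v\<leftarrow>\<sigma>. \<Sum>i\<in>I. h i v)"
  by (induction \<sigma>) (simp_all add: sum.distrib)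

lemma mean_closed_octant_simplex: "mean_closed (octant_simplex n s)"
  unfolding mean_closed_def
proof (intro allI impI, elim conjE)
  fix \<sigma> assume ne: "\<sigma> \<noteq> []" and \<sigma>: "set \<sigma> \<subseteq> octant_simplex n s"
  have scale: "s i * barycenter \<sigma> i = (\<Sum>v\<leftarrow>\<sigma>. s i * v i) / length \<sigma>" for i
    by (simp add: barycenter_def sum_list_const_mult)
  have "(\<Sum>i<n. s i * barycenter \<sigma> i) = (\<Sum>v\<leftarrow>\<sigma>. \<Sum>i<n. s i * v i) / length \<sigma>"
    by (simp add: scale sum_list_sum_swap flip: sum_divide_distrib)
  also have "(\<Sum>v\<leftarrow>\<sigma>. \<Sum>i<n. s i * v i) = (\<Sum>v\<leftarrow>\<sigma>. 1)"
    using \<sigma> by (intro arg_cong[where f = sum_list] map_cong) (auto simp: octant_simplex_def)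
  also have "\<dots> / length \<sigma> = 1"
    using ne by (simp add: sum_list_triv)
  finally have "(\<Sum>i<n. s i * barycenter \<sigma> i) = 1" .
  moreover have "s i * barycenter \<sigma> i \<ge> 0" if "i < n" for i
    unfolding scale using \<sigma> that
    by (intro divide_nonneg_nonneg sum_list_nonneg) (auto simp: octant_simplex_def)
  moreover have "barycenter \<sigma> i = 0" if "i \<ge> n" for i
  proof -
    have "(\<Sum>v\<leftarrow>\<sigma>. v i) = (\<Sum>v\<leftarrow>\<sigma>. 0)"
      using \<sigma> that by (intro arg_cong[where f = sum_list] map_cong) (auto simp: octant_simplex_def)
    then show ?thesis
      by (simp add: barycenter_def)
  qed
  ultimately show "barycenter \<sigma> \<in> octant_simplex n s"
    by (simp add: octant_simplex_def)
qed

lemma octant_simplex_subset_l1_sphere: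
  assumes "\<And>i. \<bar>s i\<bar> = 1"
  shows "octant_simplex n s \<subseteq> l1_sphere n"
proof
  fix v assume v: "v \<in> octant_simplex n s"
  have abs_eq: "\<bar>v i\<bar> = s i * v i" if "i < n" for i
  proof -
    have "\<bar>v i\<bar> = \<bar>s i * v i\<bar>"
      using assms by (simp add: abs_mult)
    also have "\<dots> = s i * v i"
      using v that by (simp add: octant_simplex_def)
    finally show ?thesis .
  qed
  have "(\<Sum>i<n. \<bar>v i\<bar>) = (\<Sum>i<n. s i * v i)"
    by (rule sum.cong[OF refl], rule abs_eq) simp
  then show "v \<in> l1_sphere n"
    using v by (auto simp only: octant_simplex_def l1_sphere_def mem_Collect_eq)
qed

lemma octahedral_sphere_support:
  assumes "octahedral_sphere k \<phi> = 1"
  shows "\<exists>\<tau> s. \<phi> \<tau> = 1 \<and> length \<tau> = k \<and> (\<forall>i. \<bar>s i\<bar> = 1) \<and>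
           (\<forall>v\<in>set \<tau>. \<exists>j<k. v = axis_point j (s j))"
  using assms
proof (induction k arbitrary: \<phi>)
  case 0
  then show ?case by (intro exI[of _ "[]"] exI[of _ "\<lambda>_. 1"]) auto
next
  case (Suc k)
  obtain \<tau> s where \<tau>:
      "\<phi> (axis_point k 1 # \<tau>) + \<phi> (axis_point k (-1) # \<tau>) = 1" "length \<tau> = k"
      "\<forall>i. \<bar>s i\<bar> = 1" "\<forall>v\<in>set \<tau>. \<exists>j<k. v = axis_point j (s j)"
    using Suc.IH[OF Suc.prems[unfolded octahedral_sphere.simps]] by blast
  obtain t :: real where t: "\<bar>t\<bar> = 1" "\<phi> (axis_point k t # \<tau>) = 1"
  proof (cases "\<phi> (axis_point k 1 # \<tau>)")
    case zero
    then show ?thesis using \<tau>(1) that[of "-1"] by simp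
  next
    case one
    then show ?thesis using that[of 1] by simp
  qed
  have "\<exists>j<Suc k. v = axis_point j ((s(k := t)) j)" if v: "v \<in> set (axis_point k t # \<tau>)" for v
  proof (cases "v = axis_point k t")
    case False
    then obtain j where "j < k" "v = axis_point j (s j)"
      using \<tau>(4) v by auto
    then show ?thesis by (intro exI[of _ j]) auto
  qed auto
  then show ?case
    using t \<tau>(2,3) by (intro exI[of _ "axis_point k t # \<tau>"] exI[of _ "s(k := t)"]) auto
qed

lemma hemisphere_support:
  assumes "hemisphere k \<phi> = 1"
  shows "\<exists>\<tau> s. \<phi> \<tau> = 1 \<and> length \<tau> = Suc k \<and> (\<forall>i. \<bar>s i\<bar> = 1) \<and>
           set \<tau> \<subseteq> octant_simplex (Suc k) s"
proof -
  obtain \<tau> s where \<tau>: "\<phi> (axis_point k 1 # \<tau>) = 1" "length \<tau> = k" "\<forall>i. \<bar>s i\<bar> = 1"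
      "\<forall>v\<in>set \<tau>. \<exists>j<k. v = axis_point j (s j)"
    using octahedral_sphere_support[of k "\<lambda>\<tau>. \<phi> (axis_point k 1 # \<tau>)"] assms
    unfolding hemisphere_def by blast
  let ?s = "s(k := 1)"
  have sq: "s i * s i = 1" for i
    using \<tau>(3) by (metis abs_mult_self_eq mult_1)
  have "axis_point j (?s j) \<in> octant_simplex (Suc k) ?s" if "j \<le> k" for j
  proof -
    have *: "?s i * axis_point j (?s j) i = (if i = j then 1 else 0)" for i
      using sq by (auto simp: axis_point_def)
    have "(\<Sum>i<Suc k. ?s i * axis_point j (?s j) i) = (\<Sum>i<Suc k. if i = j then 1 else 0)"
      by (simp only: *)
    also have "\<dots> = 1"
      using that by (subst sum.delta) auto
    finally have "(\<Sum>i<Suc k. ?s i * axis_point j (?s j) i) = 1" .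
    moreover have "?s i * axis_point j (?s j) i \<ge> 0" for i
      unfolding * by simp
    moreover have "axis_point j (?s j) i = 0" if "i \<ge> Suc k" for i
      using that \<open>j \<le> k\<close> by (simp add: axis_point_def)
    ultimately show ?thesis
      unfolding octant_simplex_def by blast
  qed
  moreover have "\<exists>j\<le>k. v = axis_point j (?s j)" if v: "v \<in> set (axis_point k 1 # \<tau>)" for v
  proof (cases "v = axis_point k 1")
    case False
    then obtain j where "j < k" "v = axis_point j (s j)"
      using \<tau>(4) v by auto
    then show ?thesis by (intro exI[of _ j]) auto
  qed auto
  ultimately have "set (axis_point k 1 # \<tau>) \<subseteq> octant_simplex (Suc k) ?s"
    by blast
  then show ?thesis
    using \<tau>(1-3) by (intro exI[of _ "axis_point k 1 # \<tau>"] exI[of _ ?s]) auto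
qed

lemma hemisphere_subdivide_support:
  assumes "hemisphere k ((subdivide ^^ N) \<phi>) = 1"
  shows "\<exists>\<tau>. \<phi> \<tau> = 1 \<and> set \<tau> \<subseteq> l1_sphere (Suc k) \<and> spread (2 * (1 - 1 / Suc k) ^ N) \<tau>"
proof -
  obtain \<sigma> s where \<sigma>: "(subdivide ^^ N) \<phi> \<sigma> = 1" "length \<sigma> = Suc k" "\<forall>i. \<bar>s i\<bar> = 1"
      "set \<sigma> \<subseteq> octant_simplex (Suc k) s"
    using hemisphere_support[OF assms] by blast
  obtain \<tau> where \<tau>: "\<phi> \<tau> = 1"
      "\<forall>S. mean_closed S \<longrightarrow> set \<sigma> \<subseteq> S \<longrightarrow> set \<tau> \<subseteq> S"
      "\<forall>r. spread r \<sigma> \<longrightarrow> spread (r * (1 - 1 / real (Suc k)) ^ N) \<tau>"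
    using iterated_subdivide_support[OF \<sigma>(1), of "Suc k"] \<sigma>(2) by auto
  have sphere: "set \<sigma> \<subseteq> l1_sphere (Suc k)"
    using octant_simplex_subset_l1_sphere[of s "Suc k"] \<sigma>(3,4) by blast
  have le1: "\<bar>v i\<bar> \<le> 1" if "v \<in> l1_sphere (Suc k)" for v i
  proof (cases "i < Suc k")
    case True
    then show ?thesis
      using that member_le_sum[of i "{..<Suc k}" "\<lambda>i. \<bar>v i\<bar>"] by (simp add: l1_sphere_def)
  qed (use that in \<open>auto simp: l1_sphere_def\<close>)
  have "\<bar>u i - v i\<bar> \<le> 2" if "u \<in> set \<sigma>" "v \<in> set \<sigma>" for u v i
  proof -
    have "\<bar>u i\<bar> \<le> 1" "\<bar>v i\<bar> \<le> 1"
      using le1 that sphere by blast+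
    then show ?thesis
      by linarith
  qed
  then have "spread 2 \<sigma>"
    by (auto simp: spread_def)
  moreover have "set \<tau> \<subseteq> l1_sphere (Suc k)"
    using \<tau>(2) \<sigma>(3,4) mean_closed_octant_simplex octant_simplex_subset_l1_sphere by blast
  ultimately show ?thesis
    using \<tau>(1,3) by auto
qed

section \<open>Products of sign changes\<close>

text \<open>The cup product of the \<open>1\<close>-cochains that mark the edges on which the sign functions \<open>s\<^sub>1, \<dots>, s\<^sub>k\<close>
  change: its value on a \<open>k\<close>-dimensional simplex is \<open>1\<close> iff \<open>s\<^sub>i\<close> changes along the \<open>i\<close>-th edge for every \<open>i\<close>. For odd
  sign functions each factor represents the generator of the cohomology of projective space.\<close>

fun sign_changes :: "('a \<Rightarrow> bit) list \<Rightarrow> 'a list \<Rightarrow> bit" where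
  "sign_changes [] [v] = 1"
| "sign_changes (s # ss) (u # v # \<tau>) = (s u + s v) * sign_changes ss (v # \<tau>)"
| "sign_changes _ _ = 0"

fun signed_head :: "('a \<Rightarrow> bit) \<Rightarrow> ('a list \<Rightarrow> bit) \<Rightarrow> 'a list \<Rightarrow> bit" where
  "signed_head s \<phi> [] = 0"
| "signed_head s \<phi> (u # \<tau>) = s u * \<phi> (u # \<tau>)"

lemma sign_changes_Nil_right [simp]: "sign_changes ss [] = 0"
  by (cases ss) simp_all

text \<open>The \<open>1\<close>-cochain of a sign function \<open>s\<close> is the coboundary of \<open>s\<close> itself, and coboundary is a
  derivation for the cup product, so a cocycle times a sign function has this coboundary.\<close>

lemma coboundary_signed_head:
  assumes "\<And>\<sigma>. coboundary (sign_changes ss) \<sigma> = 0"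
  shows "coboundary (signed_head s (sign_changes ss)) = sign_changes (s # ss)"
proof
  fix \<sigma>
  show "coboundary (signed_head s (sign_changes ss)) \<sigma> = sign_changes (s # ss) \<sigma>"
  proof (cases \<sigma>)
    case (Cons u \<tau>)
    have "sign_changes ss \<tau> + coboundary (\<lambda>\<rho>. sign_changes ss (u # \<rho>)) \<tau> = 0"
      using assms[of "u # \<tau>"] by simp
    then have "coboundary (\<lambda>\<rho>. sign_changes ss (u # \<rho>)) \<tau> = sign_changes ss \<tau>"
      by (cases "sign_changes ss \<tau>"; cases "coboundary (\<lambda>\<rho>. sign_changes ss (u # \<rho>)) \<tau>") auto
    then have "coboundary (signed_head s (sign_changes ss)) \<sigma>
        = signed_head s (sign_changes ss) \<tau> + s u * sign_changes ss \<tau>"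
      by (simp add: Cons coboundary_scale)
    then show ?thesis
      by (cases \<tau>) (simp_all add: Cons distrib_right add.commute)
  qed simp
qed

lemma coboundary_sign_changes: "coboundary (sign_changes ss) \<sigma> = 0"
proof (induction ss arbitrary: \<sigma>)
  case Nil
  show ?case
  proof (cases \<sigma>)
    case (Cons u \<tau>)
    show ?thesis
    proof (cases \<tau>)
      case Nil
      then show ?thesis by (simp add: \<open>\<sigma> = u # \<tau>\<close>)
    next
      case (Cons v \<rho>)
      then show ?thesis
        using \<open>\<sigma> = u # \<tau>\<close> by (cases \<rho>) (simp_all add: coboundary_zero)
    qed
  qed simp
next
  case (Cons s ss)
  then show ?case
    using coboundary_coboundary[of "signed_head s (sign_changes ss)" \<sigma>]
    by (simp add: coboundary_signed_head)
qed

lemma sign_changes_neg: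
  assumes "\<And>s v. s \<in> set ss \<Longrightarrow> v \<in> set \<tau> \<Longrightarrow> s (neg v) = s v + 1"
  shows "sign_changes ss (map neg \<tau>) = sign_changes ss \<tau>"
  using assms
proof (induction ss \<tau> rule: sign_changes.induct)
  case (2 s ss u v \<tau>)
  have "s (neg u) + s (neg v) = s u + s v"
  proof -
    have "s (neg u) = s u + 1" "s (neg v) = s v + 1"
      using "2.prems" by auto
    then show ?thesis
      by (cases "s u"; cases "s v") simp_all
  qed
  moreover have "sign_changes ss (map neg (v # \<tau>)) = sign_changes ss (v # \<tau>)"
    using "2.prems" by (intro "2.IH") auto
  ultimately show ?case by simp
qed auto

lemma sign_changes_support:
  assumes "sign_changes ss \<tau> = 1" "s \<in> set ss"
  shows "\<exists>u\<in>set \<tau>. \<exists>v\<in>set \<tau>. s u \<noteq> s v"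
  using assms
proof (induction ss \<tau> rule: sign_changes.induct)
  case (2 t ss u v \<tau>)
  have prod: "(t u + t v) * sign_changes ss (v # \<tau>) = 1"
    using "2.prems"(1) by simp
  have tail: "sign_changes ss (v # \<tau>) = 1"
    using prod by (cases "sign_changes ss (v # \<tau>)") simp_all
  have head: "t u \<noteq> t v"
  proof
    assume "t u = t v"
    then have "t u + t v = 0"
      by (simp only: bit_add_self)
    then show False
      using prod by simp
  qed
  show ?case
  proof (cases "s = t")
    case True
    then show ?thesis
      using head by (intro bexI[of _ u] bexI[of _ v]) simp_all
  next
    case False
    then have "s \<in> set ss"
      using "2.prems"(2) by simp
    from "2.IH"[OF tail this] show ?thesis
      by (meson list.set_intros(2))
  qed
qed auto

lemma l1_sphere_mono: "m \<le> n \<Longrightarrow> l1_sphere m \<subseteq> l1_sphere n"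
proof
  fix v assume "m \<le> n" and v: "v \<in> l1_sphere m"
  then have "(\<Sum>i<n. \<bar>v i\<bar>) = (\<Sum>i<m. \<bar>v i\<bar>)"
    by (intro sum.mono_neutral_right) (auto simp: l1_sphere_def)
  then show "v \<in> l1_sphere n"
    using v \<open>m \<le> n\<close> by (auto simp: l1_sphere_def)
qed

lemma iterated_subdivide_vertex: "(subdivide ^^ N) \<phi> [v] = \<phi> [v]"
  by (induction N) (simp_all add: subdivide_def[of _ "[v]"] barycenter_def)

text \<open>This is the nonvanishing of the top cup power in real projective space. Write the product as the
  coboundary of \<open>s\<close> times the product of the remaining factors. On a hemisphere this is the value of
  that cochain on a smaller hemisphere and its antipode. As \<open>s\<close> takes complementary values there while
  the other factors are invariant, the two values add up to the product of the other factors on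
  the smaller hemisphere. In dimension \<open>0\<close> the hemisphere is a single point.\<close>

theorem hemisphere_sign_changes:
  assumes "\<And>s v. s \<in> set ss \<Longrightarrow> v \<in> l1_sphere n \<Longrightarrow> s (neg v) = s v + 1"
    and "length ss < n"
  shows "hemisphere (length ss) ((subdivide ^^ N) (sign_changes ss)) = 1"
  using assms
proof (induction ss)
  case Nil
  show ?case by (simp add: hemisphere_def iterated_subdivide_vertex)
next
  case (Cons s ss)
  let ?k = "length ss" and ?U = "sign_changes ss"
  let ?V = "signed_head s ?U" and ?T = "subdivide ^^ N"
  let ?W = "\<lambda>\<tau>. ?V \<tau> + ?V (map neg \<tau>)"
  have "sign_changes (s # ss) = coboundary ?V"
    by (simp add: coboundary_signed_head coboundary_sign_changes)
  then have "hemisphere (Suc ?k) (?T (sign_changes (s # ss)))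
      = hemisphere ?k (\<lambda>\<tau>. ?T ?V \<tau> + ?T ?V (map neg \<tau>))"
    by (simp only: iterated_subdivide_coboundary hemisphere_coboundary)
  also have "\<dots> = hemisphere ?k (?T ?W)"
  proof -
    have "?T ?W = (\<lambda>\<tau>. ?T ?V \<tau> + ?T ?V (map neg \<tau>))"
      by (intro ext) (simp only: iterated_subdivide_add iterated_subdivide_neg)
    then show ?thesis by (simp only:)
  qed
  also have "\<dots> = hemisphere ?k (?T ?U)"
  proof (rule ccontr)
    \<comment> \<open>the two cochains agree only on simplices of the sphere, where the signs are odd\<close>
    assume "hemisphere ?k (?T ?W) \<noteq> hemisphere ?k (?T ?U)"
    then have "hemisphere ?k (?T ?W) + hemisphere ?k (?T ?U) = 1"
      by (cases "hemisphere ?k (?T ?W)"; cases "hemisphere ?k (?T ?U)") auto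
    moreover have "?T (\<lambda>\<tau>. ?W \<tau> + ?U \<tau>) = (\<lambda>\<tau>. ?T ?W \<tau> + ?T ?U \<tau>)"
      by (intro ext iterated_subdivide_add)
    ultimately have "hemisphere ?k (?T (\<lambda>\<tau>. ?W \<tau> + ?U \<tau>)) = 1"
      by (simp only: hemisphere_add)
    then obtain \<tau> where \<tau>: "?W \<tau> + ?U \<tau> = 1" "set \<tau> \<subseteq> l1_sphere (Suc ?k)"
      using hemisphere_subdivide_support by blast
    then have sub: "set \<tau> \<subseteq> l1_sphere n"
      using l1_sphere_mono[of "Suc ?k" n] Cons.prems(2) by auto
    show False
    proof (cases \<tau>)
      case (Cons u \<rho>)
      have "?U (map neg \<tau>) = ?U \<tau>"
        using sub Cons.prems(1) by (intro sign_changes_neg) auto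
      moreover have "s (neg u) = s u + 1"
        using sub Cons.prems(1) Cons by auto
      ultimately have "?W \<tau> = ?U \<tau>"
        by (cases "s u") (simp_all add: Cons)
      then show False
        using \<tau>(1) by (simp add: bit_add_self)
    qed (use \<tau>(1) in simp)
  qed
  also have "\<dots> = 1"
    using Cons by simp
  finally show ?case by simp
qed

text \<open>A sign that is odd on all nonzero points. It breaks the tie where a coordinate of an odd map
  vanishes, so that the sign functions of the coordinates are odd without exception.\<close>

definition lex_pos :: "point \<Rightarrow> bool" where
  "lex_pos v \<longleftrightarrow> (\<exists>k. v k > 0 \<and> (\<forall>i<k. v i = 0))"

lemma lex_pos_neg:
  assumes "v \<in> l1_sphere n"
  shows "lex_pos (neg v) \<longleftrightarrow> \<not> lex_pos v"
proof -
  have "\<exists>k. v k \<noteq> 0"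
  proof (rule ccontr)
    assume "\<nexists>k. v k \<noteq> 0"
    then show False using assms by (simp add: l1_sphere_def)
  qed
  then obtain k where k: "v k \<noteq> 0" "\<And>i. i < k \<Longrightarrow> v i = 0"
    using exists_least_iff[of "\<lambda>k. v k \<noteq> 0"] by auto
  have first: "j = k" if "v j \<noteq> 0" "\<And>i. i < j \<Longrightarrow> v i = 0" for j
    using that k by (metis linorder_neqE_nat)
  have "lex_pos v \<longleftrightarrow> v k > 0" "lex_pos (neg v) \<longleftrightarrow> v k < 0"
    unfolding lex_pos_def neg_def using k first by (metis less_irrefl neg_0_equal_iff_equal neg_0_less_iff_less)+
  then show ?thesis
    using k(1) by linarith
qed

definition odd_sign :: "(point \<Rightarrow> real) \<Rightarrow> point \<Rightarrow> bit" where
  "odd_sign g v = of_bool (g v > 0 \<or> g v = 0 \<and> lex_pos v)"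

text \<open>The signs of the \<open>d\<close> coordinates of \<open>G\<close> are odd, so by parity some simplex of every subdivision of the
  \<open>d\<close>-dimensional hemisphere has a sign change of every coordinate. On a simplex that is small enough, a
  coordinate that changes sign is small everywhere.\<close>

theorem approximate_borsuk_ulam:
  fixes G :: "point \<Rightarrow> nat \<Rightarrow> real"
  assumes odd: "\<And>v j. v \<in> l1_sphere (Suc d) \<Longrightarrow> j < d \<Longrightarrow> G (neg v) j = - G v j"
    and \<delta>: "\<delta> > 0"
    and close: "\<And>u v j. u \<in> l1_sphere (Suc d) \<Longrightarrow> v \<in> l1_sphere (Suc d) \<Longrightarrow>
      (\<And>i. \<bar>u i - v i\<bar> \<le> \<delta>) \<Longrightarrow> j < d \<Longrightarrow> \<bar>G u j - G v j\<bar> \<le> \<epsilon>"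
  shows "\<exists>v\<in>l1_sphere (Suc d). \<forall>j<d. \<bar>G v j\<bar> \<le> \<epsilon>"
proof -
  let ?q = "1 - 1 / real (Suc d)"
  have "?q \<ge> 0" "?q < 1"
    by (simp_all add: field_simps)
  then obtain N where N: "?q ^ N < \<delta> / 2"
    using real_arch_pow_inv[of "\<delta> / 2" ?q] \<delta> by auto
  let ?ss = "map (\<lambda>j. odd_sign (\<lambda>v. G v j)) [0..<d]"
  have "hemisphere (length ?ss) ((subdivide ^^ N) (sign_changes ?ss)) = 1"
  proof (rule hemisphere_sign_changes[where n = "Suc d"])
    fix s v assume "s \<in> set ?ss" and v: "v \<in> l1_sphere (Suc d)"
    then obtain j where "j < d" "s = odd_sign (\<lambda>v. G v j)"
      by auto
    then show "s (neg v) = s v + 1"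
      using odd[OF v, of j] lex_pos_neg[OF v] by (auto simp: odd_sign_def)
  qed simp
  then obtain \<tau> where \<tau>: "sign_changes ?ss \<tau> = 1" "set \<tau> \<subseteq> l1_sphere (Suc d)"
      "spread (2 * ?q ^ N) \<tau>"
    using hemisphere_subdivide_support[of "length ?ss" N "sign_changes ?ss"] by auto
  then obtain v where v: "v \<in> set \<tau>"
    by (cases \<tau>) auto
  have "\<bar>G v j\<bar> \<le> \<epsilon>" if j: "j < d" for j
  proof -
    have near: "\<bar>G u j - G v j\<bar> \<le> \<epsilon>" if "u \<in> set \<tau>" for u
    proof (rule close[OF _ _ _ j])
      show "\<bar>u i - v i\<bar> \<le> \<delta>" for i
      proof -
        have "\<bar>u i - v i\<bar> \<le> 2 * ?q ^ N"
          using \<tau>(3) that v unfolding spread_def by blast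
        then show ?thesis using N by linarith
      qed
    qed (use \<tau>(2) that v in auto)
    have "odd_sign (\<lambda>v. G v j) \<in> set ?ss"
      using j by auto
    then obtain u w where uw: "u \<in> set \<tau>" "w \<in> set \<tau>"
        "odd_sign (\<lambda>v. G v j) u \<noteq> odd_sign (\<lambda>v. G v j) w"
      using sign_changes_support[OF \<tau>(1)] by blast
    then have "G u j \<ge> 0 \<and> G w j \<le> 0 \<or> G u j \<le> 0 \<and> G w j \<ge> 0"
      by (auto simp: odd_sign_def split: if_splits)
    then show ?thesis
      using near[OF uw(1)] near[OF uw(2)] by linarith
  qed
  then show ?thesis
    using v \<tau>(2) by blast
qed

section \<open>Boxes and lattice paths\<close>

lemma box_antipode_apply: "i < n \<Longrightarrow> box_antipode n a b x i = a i + b i - x i"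
  by (simp add: box_antipode_def)

lemma box_antipode_involution:
  assumes "x \<in> box_boundary n a b"
  shows "box_antipode n a b (box_antipode n a b x) = x"
  using assms by (auto simp: box_antipode_def box_boundary_def n_box_def PiE_def extensional_def fun_eq_iff)

lemma box_boundary_iff:
  "x \<in> box_boundary n a b \<longleftrightarrow>
     x \<in> extensional {..<n} \<and> (\<forall>i<n. a i \<le> x i \<and> x i \<le> b i) \<and> (\<exists>i<n. x i = a i \<or> x i = b i)"
  by (auto simp: box_boundary_def n_box_def PiE_iff)

lemma box_antipode_boundary:
  assumes "x \<in> box_boundary n a b"
  shows "box_antipode n a b x \<in> box_boundary n a b"
proof -
  obtain i where i: "i < n" "x i = a i \<or> x i = b i"
    using assms by (auto simp: box_boundary_iff)
  then have "box_antipode n a b x i = a i \<or> box_antipode n a b x i = b i"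
    by (auto simp: box_antipode_apply)
  then show ?thesis
    using assms i(1) unfolding box_boundary_iff by (auto simp: box_antipode_def)
qed

lemma finite_box_boundary: "finite (box_boundary n a b)"
proof (rule finite_subset)
  show "box_boundary n a b \<subseteq> n_box n a b"
    by (auto simp: box_boundary_def)
  show "finite (n_box n a b)"
    by (auto simp: n_box_def intro: finite_PiE)
qed

lemma boundary_c_adjI:
  assumes "u \<in> box_boundary n a b" "v \<in> box_boundary n a b" "\<And>i. i < n \<Longrightarrow> \<bar>u i - v i\<bar> \<le> 1" "u \<noteq> v"
  shows "c_adj n n u v"
  using assms by (auto simp: c_adj_def lattice_points_def box_boundary_iff PiE_iff intro!: exI[of _ "{..<n}"])

text \<open>Distance in the path metric of \<open>c\<^sub>1\<close>, so that powers of this adjacency become inequalities.\<close>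

definition l1_dist :: "nat \<Rightarrow> (nat \<Rightarrow> int) \<Rightarrow> (nat \<Rightarrow> int) \<Rightarrow> int" where
  "l1_dist N x y = (\<Sum>i<N. \<bar>x i - y i\<bar>)"

lemma l1_dist_triangle: "l1_dist N x z \<le> l1_dist N x y + l1_dist N y z"
  unfolding l1_dist_def sum.distrib[symmetric] by (intro sum_mono) linarith

lemma l1_dist_le_1_if_c_adj:
  assumes "c_adj N 1 x y"
  shows "l1_dist N x y \<le> 1"
proof -
  obtain S where S: "S \<subseteq> {..<N}" "card S \<le> 1" "\<forall>i\<in>S. \<bar>x i - y i\<bar> \<le> 1"
      "\<forall>i\<in>{..<N} - S. x i = y i"
    using assms by (auto simp: c_adj_def)
  have "l1_dist N x y = (\<Sum>i\<in>S. \<bar>x i - y i\<bar>)"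
    unfolding l1_dist_def using S by (intro sum.mono_neutral_right) auto
  also have "\<dots> \<le> (\<Sum>i\<in>S. 1)"
    using S by (intro sum_mono) auto
  also have "\<dots> \<le> 1"
    using S(2) by simp
  finally show ?thesis .
qed

lemma l1_dist_le_if_adj_power:
  assumes "adj_power Y (c_adj N 1) k x y"
  shows "l1_dist N x y \<le> int k"
proof -
  obtain p where p: "p 0 = x" "p k = y" "\<And>i. i < k \<Longrightarrow> c_adj N 1 (p i) (p (Suc i)) \<or> p i = p (Suc i)"
    using assms by (auto simp: adj_power_def digital_path_def)
  have "l1_dist N x (p i) \<le> int i" if "i \<le> k" for i
    using that
  proof (induction i)
    case 0
    then show ?case by (simp add: p(1) l1_dist_def)
  next
    case (Suc i)
    have "l1_dist N (p i) (p (Suc i)) \<le> 1"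
      using p(3)[of i] Suc.prems l1_dist_le_1_if_c_adj by (auto simp: l1_dist_def)
    then show ?case
      using l1_dist_triangle[of N x "p (Suc i)" "p i"] Suc by simp
  qed
  then show ?thesis using p(2) by blast
qed

text \<open>Moving one differing coordinate a unit towards its goal brings the point one step closer.\<close>

lemma adj_power_if_l1_dist_le:
  assumes "x \<in> lattice_points N" "y \<in> lattice_points N" "l1_dist N x y \<le> int k"
  shows "adj_power (lattice_points N) (c_adj N 1) k x y"
  using assms
proof (induction k arbitrary: x)
  case 0
  have "(\<Sum>i<N. \<bar>x i - y i\<bar>) = 0"
    using "0.prems"(3) by (intro antisym sum_nonneg) (simp_all add: l1_dist_def)
  then have "\<forall>i<N. x i = y i"
    by (subst (asm) sum_nonneg_eq_0_iff) auto
  then have "x = y"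
    using "0.prems"(1,2) unfolding lattice_points_def by (intro PiE_ext) auto
  then show ?case
    using "0.prems" by (auto simp: adj_power_def digital_path_def intro!: exI[of _ "\<lambda>_. x"])
next
  case (Suc k)
  show ?case
  proof (cases "x = y")
    case True
    then show ?thesis
      using Suc.prems by (auto simp: adj_power_def digital_path_def intro!: exI[of _ "\<lambda>_. x"])
  next
    case False
    then obtain i where i: "i < N" "x i \<noteq> y i"
      using Suc.prems by (metis PiE_ext lattice_points_def lessThan_iff)
    define x' where "x' = x(i := x i + sgn (y i - x i))"
    have x': "x' \<in> lattice_points N"
      using Suc.prems(1) i(1) by (auto simp: x'_def lattice_points_def PiE_iff extensional_def)
    have "c_adj N 1 x x'"
      unfolding c_adj_def
    proof (intro conjI exI[of _ "{i}"])
      show "x \<noteq> x'"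
        using i(2) by (auto simp: x'_def fun_eq_iff sgn_if)
    qed (use Suc.prems(1) x' i in \<open>auto simp: x'_def sgn_if\<close>)
    moreover have "l1_dist N x' y \<le> int k"
    proof -
      have "l1_dist N z y = \<bar>z i - y i\<bar> + (\<Sum>j\<in>{..<N} - {i}. \<bar>z j - y j\<bar>)" for z
        using i(1) by (simp add: l1_dist_def sum.remove)
      from this[of x] this[of x'] have "l1_dist N x' y = l1_dist N x y - \<bar>x i - y i\<bar> + \<bar>x' i - y i\<bar>"
        by (simp add: x'_def)
      also have "\<dots> = l1_dist N x y - 1"
        using i(2) by (auto simp: x'_def sgn_if)
      finally show ?thesis
        using Suc.prems(3) by simp
    qed
    then obtain p where "digital_path (lattice_points N) (c_adj N 1) k x' y p"
      using Suc.IH x' Suc.prems(2) unfolding adj_power_def by blast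
    ultimately have "digital_path (lattice_points N) (c_adj N 1) (Suc k) x y
        (\<lambda>j. case j of 0 \<Rightarrow> x | Suc j \<Rightarrow> p j)"
      using Suc.prems(1) by (auto simp: digital_path_def Pi_iff split: nat.split)
    then show ?thesis
      by (auto simp: adj_power_def)
  qed
qed

section \<open>Interpolation on the boundary of a box\<close>

text \<open>The coefficient of the lattice point \<open>v\<close> in multilinear interpolation at \<open>x\<close>. It is positive only for
  corners of the unit cell of \<open>x\<close>, and any two of these differ by at most one in each coordinate.\<close>

definition hat_weight :: "nat \<Rightarrow> point \<Rightarrow> (nat \<Rightarrow> int) \<Rightarrow> real" where
  "hat_weight n x v = (\<Prod>i<n. max 0 (1 - \<bar>x i - v i\<bar>))"

lemma hat_weight_nonneg: "hat_weight n x v \<ge> 0"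
  by (simp add: hat_weight_def prod_nonneg)

lemma hat_weight_pos_iff: "hat_weight n x v > 0 \<longleftrightarrow> (\<forall>i<n. \<bar>x i - v i\<bar> < 1)"
proof -
  have "hat_weight n x v > 0 \<longleftrightarrow> hat_weight n x v \<noteq> 0"
    using hat_weight_nonneg[of n x v] by linarith
  also have "\<dots> \<longleftrightarrow> (\<forall>i<n. max 0 (1 - \<bar>x i - v i\<bar>) \<noteq> 0)"
    by (simp add: hat_weight_def Ball_def)
  also have "\<dots> \<longleftrightarrow> (\<forall>i<n. \<bar>x i - v i\<bar> < 1)"
    by (auto simp: max_def not_le)
  finally show ?thesis .
qed

lemma hat_weight_lipschitz:
  "\<bar>hat_weight n x v - hat_weight n y v\<bar> \<le> (\<Sum>i<n. \<bar>x i - y i\<bar>)"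
proof -
  let ?h = "\<lambda>x i. max 0 (1 - \<bar>x i - real_of_int (v i)\<bar>)"
  have "norm ((\<Prod>i<n. ?h x i) - (\<Prod>i<n. ?h y i)) \<le> (\<Sum>i<n. norm (?h x i - ?h y i))"
    by (rule norm_prod_diff) auto
  also have "\<dots> \<le> (\<Sum>i<n. \<bar>x i - y i\<bar>)"
    by (intro sum_mono) (auto simp: max_def)
  finally show ?thesis
    by (simp add: hat_weight_def)
qed

lemma hat_weight_round:
  assumes "\<And>i. i < n \<Longrightarrow> v i = round (x i)"
  shows "hat_weight n x v \<ge> (1 / 2) ^ n"
proof -
  have "(\<Prod>i<n. 1 / 2) \<le> (\<Prod>i<n. max 0 (1 - \<bar>x i - v i\<bar>))"
  proof (rule prod_mono)
    fix i assume "i \<in> {..<n}"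
    then have "\<bar>x i - v i\<bar> \<le> 1 / 2"
      using of_int_round_abs_le[of "x i"] assms by (simp add: abs_minus_commute)
    then show "0 \<le> (1 / 2 :: real) \<and> 1 / 2 \<le> max 0 (1 - \<bar>x i - v i\<bar>)"
      by simp
  qed
  then show ?thesis
    by (simp add: hat_weight_def)
qed

text \<open>An odd map of the \<open>\<ell>\<^sub>1\<close> sphere to the boundary of the real box. Clamping replaces radial projection, and
  the factor \<open>n\<close> ensures that some coordinate reaches a face, since a point of the \<open>\<ell>\<^sub>1\<close> sphere has a
  coordinate of absolute value at least \<open>1 / n\<close>.\<close>

definition cube_map :: "nat \<Rightarrow> (nat \<Rightarrow> int) \<Rightarrow> (nat \<Rightarrow> int) \<Rightarrow> point \<Rightarrow> point" where
  "cube_map n a b y = (\<lambda>i. (a i + b i) / 2 + (b i - a i) / 2 * max (-1) (min 1 (n * y i)))"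

lemma cube_map_bounds:
  assumes "a i < b i"
  shows "a i \<le> cube_map n a b y i \<and> cube_map n a b y i \<le> b i"
proof -
  define t where "t = max (-1) (min 1 (n * y i))"
  have t: "-1 \<le> t" "t \<le> 1"
    by (auto simp: t_def)
  have "\<bar>(real_of_int (b i) - a i) / 2 * t\<bar> \<le> (real_of_int (b i) - a i) / 2 * 1"
    unfolding abs_mult using t assms by (intro mult_mono) auto
  then show ?thesis
    unfolding cube_map_def t_def[symmetric] by (auto simp: abs_le_iff field_simps)
qed

lemma cube_map_on_face:
  assumes "y \<in> l1_sphere n"
  shows "\<exists>i<n. cube_map n a b y i = a i \<or> cube_map n a b y i = b i"
proof -
  have "\<exists>i<n. \<bar>n * y i\<bar> \<ge> 1"
  proof (rule ccontr)
    assume "\<not> ?thesis"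
    then have less: "n * \<bar>y i\<bar> < 1" if "i < n" for i
      using that by (auto simp: abs_mult not_le)
    have n: "n > 0"
      using assms by (cases n) (auto simp: l1_sphere_def)
    have "n * (\<Sum>i<n. \<bar>y i\<bar>) < (\<Sum>i<n. 1)"
      unfolding sum_distrib_left using less n by (intro sum_strict_mono) auto
    then show False
      using assms by (simp add: l1_sphere_def)
  qed
  then obtain i where i: "i < n" "n * y i \<ge> 1 \<or> n * y i \<le> -1"
    by (auto simp: abs_if split: if_splits)
  then have "max (-1) (min 1 (n * y i)) = 1 \<or> max (-1) (min 1 (n * y i)) = -1"
    by linarith
  then have "cube_map n a b y i = b i \<or> cube_map n a b y i = a i"
    unfolding cube_map_def by (elim disjE) (simp_all add: field_simps)
  then show ?thesis
    using i(1) by blast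
qed

lemma cube_map_lipschitz:
  assumes "a i < b i"
  shows "\<bar>cube_map n a b y i - cube_map n a b z i\<bar> \<le> (b i - a i) * n * \<bar>y i - z i\<bar>"
proof -
  let ?c = "\<lambda>y :: point. max (-1) (min 1 (real n * y i))"
  have "\<bar>?c y - ?c z\<bar> \<le> \<bar>n * y i - n * z i\<bar>"
    by (auto simp: max_def min_def)
  also have "\<dots> = n * \<bar>y i - z i\<bar>"
    by (simp add: abs_mult flip: right_diff_distrib)
  finally have le: "\<bar>?c y - ?c z\<bar> \<le> n * \<bar>y i - z i\<bar>" .
  have "cube_map n a b y i - cube_map n a b z i = (b i - a i) / 2 * (?c y - ?c z)"
    by (simp add: cube_map_def right_diff_distrib)
  also have "\<bar>\<dots>\<bar> = (b i - a i) / 2 * \<bar>?c y - ?c z\<bar>"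
    using assms by (simp add: abs_mult)
  finally have "\<bar>cube_map n a b y i - cube_map n a b z i\<bar> = (b i - a i) / 2 * \<bar>?c y - ?c z\<bar>" .
  also have "\<dots> \<le> (b i - a i) * (n * \<bar>y i - z i\<bar>)"
    using assms le by (intro mult_mono) auto
  finally show ?thesis by (simp add: mult.assoc)
qed

lemma hat_weight_antipode:
  "hat_weight n (cube_map n a b (neg y)) (box_antipode n a b v) = hat_weight n (cube_map n a b y) v"
proof -
  have clamp: "max (-1) (min 1 (- t)) = - max (-1) (min 1 t)" for t :: real
    by (auto simp: max_def min_def)
  have "cube_map n a b (neg y) i - box_antipode n a b v i = - (cube_map n a b y i - v i)" if "i < n" for i
    using that by (simp add: cube_map_def neg_def clamp box_antipode_apply field_simps)
  then show ?thesis
    unfolding hat_weight_def by (intro prod.cong) (auto simp: abs_minus_commute)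
qed

text \<open>The bounds of the box are integers, so rounding stays inside it and keeps a point on its face.\<close>

lemma round_cube_map_in_boundary:
  assumes ab: "\<And>i. i < n \<Longrightarrow> a i < b i" and y: "y \<in> l1_sphere n"
  shows "(\<lambda>i\<in>{..<n}. round (cube_map n a b y i)) \<in> box_boundary n a b"
proof -
  have "a i \<le> round (cube_map n a b y i) \<and> round (cube_map n a b y i) \<le> b i" if "i < n" for i
    using round_mono[of "real_of_int (a i)" "cube_map n a b y i"]
      round_mono[of "cube_map n a b y i" "real_of_int (b i)"] cube_map_bounds[of a i b n y] ab[OF that]
    by simp
  moreover obtain i where "i < n" "cube_map n a b y i = a i \<or> cube_map n a b y i = b i"
    using cube_map_on_face[OF y] by blast
  ultimately show ?thesis
    by (auto simp: box_boundary_iff intro!: exI[of _ i])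
qed

text \<open>A nearly vanishing weighted average of vectors that are all close to one of them forces that one to be
  nearly as short as this closeness. The lower bound on a single weight stands in for the total weight.\<close>

lemma l1_norm_le_if_average_small:
  fixes g :: "'a \<Rightarrow> nat \<Rightarrow> real"
  assumes B: "finite B" "v\<^sub>0 \<in> B" and w: "\<And>v. v \<in> B \<Longrightarrow> w v \<ge> 0" and c: "w v\<^sub>0 \<ge> c" "c > 0"
    and near: "\<And>v. v \<in> B \<Longrightarrow> w v > 0 \<Longrightarrow> (\<Sum>j<d. \<bar>g v\<^sub>0 j - g v j\<bar>) \<le> M"
    and small: "\<And>j. j < d \<Longrightarrow> \<bar>\<Sum>v\<in>B. w v * g v j\<bar> \<le> \<eta>"
  shows "(\<Sum>j<d. \<bar>g v\<^sub>0 j\<bar>) \<le> M + d * \<eta> / c"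
proof -
  let ?W = "\<Sum>v\<in>B. w v"
  have W: "?W \<ge> c"
    using member_le_sum[of v\<^sub>0 B w] B w c by simp
  have \<eta>: "d * \<eta> \<ge> 0"
  proof (cases d)
    case (Suc k)
    then have "\<eta> \<ge> 0"
      using small[of 0] by linarith
    then show ?thesis by simp
  qed simp
  have "?W * (\<Sum>j<d. \<bar>g v\<^sub>0 j\<bar>) = (\<Sum>j<d. \<bar>\<Sum>v\<in>B. w v * g v\<^sub>0 j\<bar>)"
    using W c(2) by (simp add: sum_distrib_left abs_mult flip: sum_distrib_right)
  also have "\<dots> \<le> (\<Sum>j<d. (\<Sum>v\<in>B. w v * \<bar>g v\<^sub>0 j - g v j\<bar>) + \<eta>)"
  proof (rule sum_mono)
    fix j assume j: "j \<in> {..<d}"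
    have "(\<Sum>v\<in>B. w v * g v\<^sub>0 j) = (\<Sum>v\<in>B. w v * (g v\<^sub>0 j - g v j)) + (\<Sum>v\<in>B. w v * g v j)"
      by (simp add: right_diff_distrib sum_subtractf)
    moreover have "\<bar>\<Sum>v\<in>B. w v * (g v\<^sub>0 j - g v j)\<bar> \<le> (\<Sum>v\<in>B. w v * \<bar>g v\<^sub>0 j - g v j\<bar>)"
      by (rule order_trans[OF sum_abs]) (use w in \<open>simp add: abs_mult\<close>)
    ultimately show "\<bar>\<Sum>v\<in>B. w v * g v\<^sub>0 j\<bar> \<le> (\<Sum>v\<in>B. w v * \<bar>g v\<^sub>0 j - g v j\<bar>) + \<eta>"
      using small[of j] j by simp
  qed
  also have "\<dots> = (\<Sum>v\<in>B. w v * (\<Sum>j<d. \<bar>g v\<^sub>0 j - g v j\<bar>)) + d * \<eta>"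
    by (simp add: sum.distrib sum_distrib_left) (rule sum.swap)
  also have "(\<Sum>v\<in>B. w v * (\<Sum>j<d. \<bar>g v\<^sub>0 j - g v j\<bar>)) \<le> (\<Sum>v\<in>B. w v * M)"
  proof (rule sum_mono)
    fix v assume v: "v \<in> B"
    show "w v * (\<Sum>j<d. \<bar>g v\<^sub>0 j - g v j\<bar>) \<le> w v * M"
      using near[OF v] w[OF v] by (cases "w v = 0") (auto intro: mult_left_mono)
  qed
  also have "\<dots> = ?W * M"
    by (simp add: sum_distrib_right)
  finally have "?W * ((\<Sum>j<d. \<bar>g v\<^sub>0 j\<bar>) - M) \<le> d * \<eta>"
    by (simp add: right_diff_distrib)
  then have "(\<Sum>j<d. \<bar>g v\<^sub>0 j\<bar>) - M \<le> d * \<eta> / ?W"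
    using W c(2) by (simp add: field_simps)
  also have "\<dots> \<le> d * \<eta> / c"
    using W c(2) \<eta> by (intro divide_left_mono) auto
  finally show ?thesis by simp
qed

section \<open>Nearby images of antipodal points\<close>

theorem theorem5p5:
  fixes n m :: nat
    and a b :: "nat \<Rightarrow> int"
    and f :: "(nat \<Rightarrow> int) \<Rightarrow> (nat \<Rightarrow> int)"
  assumes "n \<ge> 2" and "m \<ge> 1"
    and "\<And>i. i < n \<Longrightarrow> a i < b i"
    and "digitally_continuous (box_boundary n a b) (c_adj n n)
           (lattice_points (n - 1)) (adj_power (lattice_points (n - 1)) (c_adj (n - 1) 1) m) f"
  shows "\<exists>x \<in> box_boundary n a b.
           f x = f (box_antipode n a b x) \<or>
           adj_power (lattice_points (n - 1)) (c_adj (n - 1) 1) (2 * m)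
             (f x) (f (box_antipode n a b x))"
proof -
  define d where "d = n - 1"
  have n: "n = Suc d"
    using assms(1) by (simp add: d_def)
  note ab = assms(3)
  let ?B = "box_boundary n a b" and ?A = "box_antipode n a b"
  have f_lattice: "f v \<in> lattice_points d" if "v \<in> ?B" for v
    using assms(4) that by (auto simp: digitally_continuous_def d_def)
  have f_close: "l1_dist d (f u) (f v) \<le> int m"
    if "u \<in> ?B" "v \<in> ?B" "\<And>i. i < n \<Longrightarrow> \<bar>u i - v i\<bar> \<le> 1" for u v
  proof (cases "f u = f v")
    case False
    then have "c_adj n n u v"
      using that by (intro boundary_c_adjI) auto
    then have "adj_power (lattice_points d) (c_adj d 1) m (f u) (f v)"
      using assms(4) that(1,2) False unfolding digitally_continuous_def d_def by blast
    then show ?thesis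
      by (rule l1_dist_le_if_adj_power)
  qed (simp add: l1_dist_def)
  \<comment> \<open>an odd function, whose values are wanted within distance \<open>2 m\<close> of the origin\<close>
  define g where "g v j = real_of_int (f v j - f (?A v) j)" for v j
  have g_odd: "g (?A v) j = - g v j" if "v \<in> ?B" for v j
    using that by (simp add: g_def box_antipode_involution)
  have g_close: "(\<Sum>j<d. \<bar>g u j - g v j\<bar>) \<le> 2 * m"
    if "u \<in> ?B" "v \<in> ?B" "\<And>i. i < n \<Longrightarrow> \<bar>u i - v i\<bar> \<le> 1" for u v
  proof -
    have "(\<Sum>j<d. \<bar>g u j - g v j\<bar>)
        \<le> (\<Sum>j<d. real_of_int (\<bar>f u j - f v j\<bar> + \<bar>f (?A u) j - f (?A v) j\<bar>))"
      unfolding g_def by (intro sum_mono) linarith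
    also have "\<dots> = real_of_int (l1_dist d (f u) (f v) + l1_dist d (f (?A u)) (f (?A v)))"
      by (simp add: l1_dist_def sum.distrib)
    also have "\<dots> \<le> real_of_int (int m + int m)"
      unfolding of_int_le_iff using that
      by (intro add_mono f_close) (auto simp: box_antipode_boundary box_antipode_apply abs_minus_commute)
    finally show ?thesis by simp
  qed
  let ?w = "\<lambda>y. hat_weight n (cube_map n a b y)"
  define G where "G y j = (\<Sum>v\<in>?B. ?w y v * g v j)" for y j
  \<comment> \<open>small enough that \<open>d * \<eta>\<close>, divided by the lower bound for the weight of a nearest lattice point, is below \<open>1\<close>\<close>
  define \<eta> :: real where "\<eta> = (1 / 2) ^ n / n"
  \<comment> \<open>\<open>K\<close> exceeds a common Lipschitz constant of all coordinates of \<open>G\<close>\<close>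
  define R where "R = (\<Sum>i<n. (b i - a i) * real n)"
  define K where "K = (\<Sum>j<d. \<Sum>v\<in>?B. \<bar>g v j\<bar>) * R + 1"
  have R: "R \<ge> 0"
    unfolding R_def using ab by (intro sum_nonneg) (auto intro: less_imp_le)
  have K: "K > 0"
    unfolding K_def using R by (intro add_nonneg_pos mult_nonneg_nonneg sum_nonneg) auto
  have \<eta>: "\<eta> > 0"
    using n by (simp add: \<eta>_def)
  have "\<exists>y\<in>l1_sphere (Suc d). \<forall>j<d. \<bar>G y j\<bar> \<le> \<eta>"
  proof (rule approximate_borsuk_ulam[where \<delta> = "\<eta> / K"])
    fix y j
    have "G (neg y) j = (\<Sum>v\<in>?B. ?w (neg y) (?A v) * g (?A v) j)"
      unfolding G_def
      by (rule sum.reindex_bij_witness[of _ ?A ?A])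
        (auto simp: box_antipode_involution box_antipode_boundary)
    also have "\<dots> = - G y j"
      by (simp add: G_def hat_weight_antipode g_odd flip: sum_negf)
    finally show "G (neg y) j = - G y j" .
  next
    fix y z :: point and j assume yz: "\<And>i. \<bar>y i - z i\<bar> \<le> \<eta> / K" and j: "j < d"
    have w: "\<bar>?w y v - ?w z v\<bar> \<le> R * (\<eta> / K)" for v
    proof -
      have "\<bar>?w y v - ?w z v\<bar> \<le> (\<Sum>i<n. \<bar>cube_map n a b y i - cube_map n a b z i\<bar>)"
        by (rule hat_weight_lipschitz)
      also have "\<dots> \<le> (\<Sum>i<n. (b i - a i) * real n * (\<eta> / K))"
      proof (rule sum_mono)
        fix i assume "i \<in> {..<n}"
        then have i: "a i < b i" using ab by simp
        have "(b i - a i) * real n * \<bar>y i - z i\<bar> \<le> (b i - a i) * real n * (\<eta> / K)"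
          using i yz by (intro mult_left_mono) auto
        with cube_map_lipschitz[of a i b n y z, OF i]
        show "\<bar>cube_map n a b y i - cube_map n a b z i\<bar> \<le> (b i - a i) * real n * (\<eta> / K)"
          unfolding of_int_diff by linarith
      qed
      also have "\<dots> = R * (\<eta> / K)"
        by (simp only: R_def sum_distrib_right)
      finally show ?thesis .
    qed
    have "\<bar>G y j - G z j\<bar> = \<bar>\<Sum>v\<in>?B. (?w y v - ?w z v) * g v j\<bar>"
      by (simp add: G_def left_diff_distrib sum_subtractf)
    also have "\<dots> \<le> (\<Sum>v\<in>?B. R * (\<eta> / K) * \<bar>g v j\<bar>)"
      by (rule order_trans[OF sum_abs], rule sum_mono, unfold abs_mult)
        (intro mult_right_mono w abs_ge_zero)
    also have "\<dots> = (\<Sum>v\<in>?B. \<bar>g v j\<bar>) * (R * (\<eta> / K))"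
      by (simp add: sum_distrib_left mult.commute)
    also have "\<dots> \<le> (\<Sum>j<d. \<Sum>v\<in>?B. \<bar>g v j\<bar>) * (R * (\<eta> / K))"
      using j R \<eta> K
      by (intro mult_right_mono member_le_sum[where f = "\<lambda>j. \<Sum>v\<in>?B. \<bar>g v j\<bar>"] sum_nonneg) auto
    also have "\<dots> = (K - 1) * \<eta> / K"
      by (simp add: K_def)
    also have "\<dots> \<le> \<eta>"
      using K \<eta> by (simp add: field_simps)
    finally show "\<bar>G y j - G z j\<bar> \<le> \<eta>" .
  qed (use \<eta> K in simp)
  then obtain y where y: "y \<in> l1_sphere n" and small: "\<And>j. j < d \<Longrightarrow> \<bar>G y j\<bar> \<le> \<eta>"
    using n by auto
  define x where "x = (\<lambda>i\<in>{..<n}. round (cube_map n a b y i))"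
  have x: "x \<in> ?B"
    unfolding x_def by (rule round_cube_map_in_boundary[OF ab y])
  have wx: "?w y x \<ge> (1 / 2) ^ n"
    by (rule hat_weight_round) (simp add: x_def)
  have "(\<Sum>j<d. \<bar>g x j\<bar>) \<le> 2 * m + d * \<eta> / (1 / 2) ^ n"
  proof (rule l1_norm_le_if_average_small[where B = ?B and w = "?w y"])
    fix v assume v: "v \<in> ?B" "?w y v > 0"
    have "?w y x > 0"
      using wx by (rule less_le_trans[rotated]) simp
    have "\<bar>x i - v i\<bar> \<le> 1" if "i < n" for i
    proof -
      have "\<bar>cube_map n a b y i - x i\<bar> < 1" "\<bar>cube_map n a b y i - v i\<bar> < 1"
        using v(2) \<open>?w y x > 0\<close> that by (auto simp: hat_weight_pos_iff)
      then show ?thesis by linarith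
    qed
    then show "(\<Sum>j<d. \<bar>g x j - g v j\<bar>) \<le> real (2 * m)"
      using g_close[OF x v(1)] by simp
  qed (use x wx small in \<open>auto simp: finite_box_boundary hat_weight_nonneg G_def\<close>)
  also have "d * \<eta> / (1 / 2) ^ n = d / n"
    by (simp add: \<eta>_def)
  also have "\<dots> < 1"
    by (simp add: n)
  \<comment> \<open>the left side is an integer, which absorbs the error below \<open>1\<close>\<close>
  finally have "real_of_int (l1_dist d (f x) (f (?A x))) < real_of_int (2 * int m + 1)"
    by (simp add: l1_dist_def g_def)
  then have "l1_dist d (f x) (f (?A x)) \<le> int (2 * m)"
    by simp
  then have "adj_power (lattice_points d) (c_adj d 1) (2 * m) (f x) (f (?A x))"
    by (intro adj_power_if_l1_dist_le f_lattice x box_antipode_boundary)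
  then show ?thesis
    using x by (auto simp: d_def)
qed

end
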